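(* Let $y_0>0$ and $s_0\in\{-1,+1\}$. Then $g(y_0,s_0)<\infty$ if $$\rho>\mu-\lambda+\sqrt{\sigma^2+\lambda^2}.\qquad(\ast)$$ In fact, condition $(\ast)$ holds if and only if $E_{y_0,s_0}\left(\sup_{t\ge 0}|X_t|\right)<\infty$, while $\rho<\mu-\lambda+\sqrt{\sigma^2+\lambda^2}$ if and only if $\sup_{t\ge 0}E_{y_0,s_0}(X_t)=+\infty$.
   Context: Fix real parameters $\lambda>0$, $\mu>0$, $\sigma>0$, $a>0$, $\rho>0$. Let $(\xi(t),t\ge 0)$ be the continuous-time Markov chain with (right-continuous) piecewise constant paths in $S=\{-1,+1\}$, which jumps from each state to the other at rate $\lambda$ (infinitesimal generator $\begin{pmatrix}-\lambda&\lambda\\ \lambda&-\lambda\end{pmatrix}$). For $Y_0\ge 0$, let $Y_t=Y_0\exp\left(\mu t+\sigma\int_0^t\xi(u)\,du\right)$, i.e. $dY_t/dt=(\mu+\sigma\xi(t))Y_t$. Let $(\mathcal F_t)$ be the completed natural filtration of $(\xi(t))$. $P_{y,s}$ and $E_{y,s}$ denote probability and expectation given $Y_0=y$, $\xi(0)=s$. The reward process is $X_t=e^{-\rho t}(Y_t-a)$ for $0\le t<\infty$, and $X_{+\infty}=0$. The value function is $g(y,s)=\sup_\tau E_{y,s}(X_\tau)$, the supremum being over all $(\mathcal F_t)$-stopping times $\tau$ with values in $[0,\infty]$ (note that $X_t\ge -a$, so the expectations are well defined in $(-\infty,+\infty]$). *)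

theory Defs
  imports "HOL-Probability.Probability"
begin

section \<open>Continuous-time Markov chains on a finite state space\<close>

definition transition_semigroup :: "'s set \<Rightarrow> (real \<Rightarrow> 's \<Rightarrow> 's \<Rightarrow> real) \<Rightarrow> bool" where
  "transition_semigroup S p \<longleftrightarrow>
     (\<forall>t\<ge>0. \<forall>i\<in>S. (\<forall>j\<in>S. 0 \<le> p t i j) \<and> (\<Sum>j\<in>S. p t i j) = 1) \<and>
     (\<forall>i\<in>S. \<forall>j\<in>S. p 0 i j = (if i = j then 1 else 0)) \<and>
     (\<forall>s\<ge>0. \<forall>t\<ge>0. \<forall>i\<in>S. \<forall>j\<in>S. p (s + t) i j = (\<Sum>k\<in>S. p s i k * p t k j))"

definition infinitesimal_generator ::
    "'s set \<Rightarrow> (real \<Rightarrow> 's \<Rightarrow> 's \<Rightarrow> real) \<Rightarrow> ('s \<Rightarrow> 's \<Rightarrow> real) \<Rightarrow> bool" where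
  "infinitesimal_generator S p Q \<longleftrightarrow>
     (\<forall>i\<in>S. \<forall>j\<in>S. ((\<lambda>t. p t i j) has_real_derivative Q i j) (at 0 within {0..}))"

text \<open>Filtrations are indexed by the extended half-line \<open>[0, \<infinity>]\<close>, so that the stopping times
  of the library, which take values in the index set, may be infinite.  At the index \<open>\<infinity>\<close>
  the filtration is generated by the whole process.\<close>

definition natural_filtration ::
    "'a measure \<Rightarrow> (real \<Rightarrow> 'a \<Rightarrow> real) \<Rightarrow> ennreal \<Rightarrow> 'a measure" where
  "natural_filtration M \<xi> t =
     sigma (space M) {\<xi> u -` B \<inter> space M | u B. 0 \<le> u \<and> ennreal u \<le> t \<and> B \<in> sets borel}"

definition completed_filtration ::
    "'a measure \<Rightarrow> (real \<Rightarrow> 'a \<Rightarrow> real) \<Rightarrow> ennreal \<Rightarrow> 'a measure" where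
  "completed_filtration M \<xi> t =
     sigma (space M) (sets (natural_filtration M \<xi> t) \<union> null_sets (completion M))"

definition piecewise_constant_path :: "(real \<Rightarrow> real) \<Rightarrow> bool" where
  "piecewise_constant_path f \<longleftrightarrow>
     (\<forall>T. \<exists>D. finite D \<and> (\<forall>s t. 0 \<le> s \<and> s \<le> t \<and> t \<le> T \<and> {s..t} \<inter> D = {} \<longrightarrow> f s = f t))"

text \<open>The process \<open>\<xi>\<close> is only looked at for times \<open>t \<ge> 0\<close>.  For finite \<open>S\<close>, the generator
  \<open>Q\<close> determines the transition semigroup \<open>p\<close> at times \<open>t \<ge> 0\<close>.\<close>

definition markov_chain ::
    "'a measure \<Rightarrow> real set \<Rightarrow> (real \<Rightarrow> real \<Rightarrow> real) \<Rightarrow> (real \<Rightarrow> 'a \<Rightarrow> real) \<Rightarrow> bool" where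
  "markov_chain M S Q \<xi> \<longleftrightarrow>
     prob_space M \<and> finite S \<and>
     (\<forall>t\<ge>0. \<xi> t \<in> borel_measurable M) \<and>
     (\<forall>\<omega>\<in>space M. (\<forall>t\<ge>0. \<xi> t \<omega> \<in> S) \<and>
        (\<forall>t\<ge>0. continuous (at_right t) (\<lambda>u. \<xi> u \<omega>)) \<and>
        piecewise_constant_path (\<lambda>u. \<xi> u \<omega>)) \<and>
     (\<exists>p. transition_semigroup S p \<and> infinitesimal_generator S p Q \<and>
        (\<forall>s\<ge>0. \<forall>t\<ge>0. \<forall>j\<in>S. AE \<omega> in M.
           real_cond_exp M (natural_filtration M \<xi> (ennreal s))
             (indicator {\<omega>\<in>space M. \<xi> (s + t) \<omega> = j}) \<omega> = p t (\<xi> s \<omega>) j))"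

section \<open>The two-state chain, the price process and the reward\<close>

definition states :: "real set" where
  "states = {-1, 1}"

definition flip_generator :: "real \<Rightarrow> real \<Rightarrow> real \<Rightarrow> real" where
  "flip_generator rate i j = (if i = j then - rate else rate)"

text \<open>A realisation of the flip chain under the law conditioned on \<open>\<xi> 0 = s\<close>.\<close>

definition flip_chain_from ::
    "real \<Rightarrow> real \<Rightarrow> 'a measure \<Rightarrow> (real \<Rightarrow> 'a \<Rightarrow> real) \<Rightarrow> bool" where
  "flip_chain_from rate s M \<xi> \<longleftrightarrow>
     markov_chain M states (flip_generator rate) \<xi> \<and> (AE \<omega> in M. \<xi> 0 \<omega> = s)"

definition price ::
    "real \<Rightarrow> real \<Rightarrow> (real \<Rightarrow> 'a \<Rightarrow> real) \<Rightarrow> real \<Rightarrow> real \<Rightarrow> 'a \<Rightarrow> real" where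
  "price \<mu> \<sigma> \<xi> y t \<omega> = y * exp (\<mu> * t + \<sigma> * integral {0..t} (\<lambda>u. \<xi> u \<omega>))"

definition reward ::
    "real \<Rightarrow> real \<Rightarrow> real \<Rightarrow> real \<Rightarrow> (real \<Rightarrow> 'a \<Rightarrow> real) \<Rightarrow> real \<Rightarrow> ennreal \<Rightarrow> 'a \<Rightarrow> real" where
  "reward \<mu> \<sigma> a \<rho> \<xi> y t \<omega> =
     (if t = \<infinity> then 0
      else exp (- \<rho> * enn2real t) * (price \<mu> \<sigma> \<xi> y (enn2real t) \<omega> - a))"

text \<open>Extended expectation, with values in \<open>(-\<infinity>, \<infinity>]\<close> for integrands that are bounded below:
  \<open>ennreal\<close> maps negative reals to 0, so the two integrals are those of the positive and the
  negative part.  No completion of \<open>M\<close> is needed for integrands that are only measurable with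
  respect to the completion: \<open>nn_integral (completion M) f = nn_integral M f\<close> for every \<open>f\<close>.\<close>

definition ext_expectation :: "'a measure \<Rightarrow> ('a \<Rightarrow> real) \<Rightarrow> ereal" where
  "ext_expectation M f =
     enn2ereal (\<integral>\<^sup>+\<omega>. ennreal (f \<omega>) \<partial>M) - enn2ereal (\<integral>\<^sup>+\<omega>. ennreal (- f \<omega>) \<partial>M)"

text \<open>The dependence of the value on the starting state is through \<open>M\<close> and \<open>\<xi>\<close>.\<close>

definition value_function ::
    "real \<Rightarrow> real \<Rightarrow> real \<Rightarrow> real \<Rightarrow> 'a measure \<Rightarrow> (real \<Rightarrow> 'a \<Rightarrow> real) \<Rightarrow> real \<Rightarrow> ereal" where
  "value_function \<mu> \<sigma> a \<rho> M \<xi> y =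
     (SUP \<tau> \<in> {\<tau>. stopping_time (completed_filtration M \<xi>) \<tau>}.
        ext_expectation M (\<lambda>\<omega>. reward \<mu> \<sigma> a \<rho> \<xi> y (\<tau> \<omega>) \<omega>))"

end

theory Submission
  imports Defs
begin

text \<open>With \<open>\<kappa> = sqrt (\<theta>\<^sup>2 + rate\<^sup>2) - rate\<close> and \<open>A t = \<integral>\<^sub>0\<^sup>t \<xi>\<close>, the expectation of
  \<open>(\<theta> + \<kappa> \<xi> t) exp (\<theta> A t)\<close> is exactly proportional to \<open>exp (\<kappa> t)\<close>, so \<open>E exp (\<theta> A t)\<close> lies
  between two positive multiples of \<open>exp (\<kappa> t)\<close>; for \<open>\<theta> = \<sigma>\<close> this settles \<open>sup E X\<close>.  The identity
  is obtained by replacing \<open>A t\<close> with right Riemann sums, which converge because the paths are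
  right-continuous, and iterating the Markov property along the grid.  Above the critical discount
  rate, \<open>sup |X|\<close> is dominated by a constant plus a multiple of the sum of the discounted prices at
  integer times, whose expectations decay geometrically.  At or below it, an integrable supremum
  would contradict dominated convergence: the critically discounted price tends to 0 almost surely,
  since its square root has summable expectations, but its expectation stays away from 0.\<close>

section \<open>Riemann sums of right-continuous functions\<close>

text \<open>Sampling \<open>f\<close> at right grid endpoints gives step functions whose integrals
  are the Riemann sums. Right-continuity makes them converge pointwise on the interval, and
  dominated convergence for the gauge integral yields integrability of \<open>f\<close> and the
  limit together.\<close>

lemma right_riemann_sums_tendsto:
  fixes f :: "real \<Rightarrow> real"
  assumes T: "0 \<le> T"
    and bound: "\<And>t. t \<in> {0..T} \<Longrightarrow> \<bar>f t\<bar> \<le> B"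
    and cont: "\<And>t. t \<in> {0..T} \<Longrightarrow> continuous (at_right t) f"
  shows "f integrable_on {0..T}"
    and "(\<lambda>n. T / Suc n * (\<Sum>k<Suc n. f (T / Suc n * Suc k))) \<longlonglongrightarrow> integral {0..T} f"
proof -
  have "f integrable_on {0..T} \<and>
      (\<lambda>n. T / Suc n * (\<Sum>k<Suc n. f (T / Suc n * Suc k))) \<longlonglongrightarrow> integral {0..T} f"
  proof (cases "T = 0")
    case True
    then show ?thesis by (simp add: integrable_on_refl[of f 0, simplified])
  next
    case False
    with T have T: "T > 0" by simp
    define \<delta> where "\<delta> n = T / Suc n" for n
    \<comment> \<open>The first grid point at or after \<open>u\<close>. It approaches
      \<open>u\<close> from the right, the side on which \<open>f\<close> is continuous.\<close>
    define r where "r n u = \<delta> n * \<lceil>u / \<delta> n\<rceil>" for n u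
    have \<delta>: "\<delta> n > 0" for n using T by (simp add: \<delta>_def)
    have r_ge: "u \<le> r n u" for n u
    proof -
      have "u / \<delta> n \<le> \<lceil>u / \<delta> n\<rceil>" by linarith
      from mult_left_mono[OF this, of "\<delta> n"] \<delta>[of n] show ?thesis by (simp add: r_def)
    qed
    have r_less: "r n u < u + \<delta> n" for n u
    proof -
      have "\<lceil>u / \<delta> n\<rceil> < u / \<delta> n + 1" by linarith
      then show ?thesis using \<delta>[of n] by (simp add: r_def field_simps)
    qed
    have r_le: "r n u \<le> T" if "u \<le> T" for n u
    proof -
      have "u / \<delta> n \<le> Suc n"
        using mult_right_mono[OF that, of "Suc n"] T
        by (simp add: \<delta>_def divide_le_eq del: of_nat_Suc)
      then have "\<lceil>u / \<delta> n\<rceil> \<le> int (Suc n)" by (simp add: ceiling_le_iff)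
      then have "real_of_int \<lceil>u / \<delta> n\<rceil> \<le> Suc n" by linarith
      then have "r n u \<le> \<delta> n * Suc n"
        unfolding r_def using \<delta>[of n] by (intro mult_left_mono) simp_all
      then show ?thesis by (simp add: \<delta>_def)
    qed
    have step: "((\<lambda>u. f (r n u)) has_integral (\<Sum>k<m. \<delta> n * f (\<delta> n * Suc k))) {0..\<delta> n * m}"
      for n m
    proof (induction m)
      case 0
      then show ?case using has_integral_refl(2)[of "\<lambda>u. f (r n u)" 0] by simp
    next
      case (Suc m)
      have "((\<lambda>u. f (r n u)) has_integral \<delta> n * f (\<delta> n * Suc m)) {\<delta> n * m..\<delta> n * Suc m}"
      \<comment> \<open>At the left endpoint the ceiling is \<open>m\<close> instead of
        \<open>Suc m\<close>, so that single point is discarded.\<close>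
      proof (rule has_integral_spike_finite[where S = "{\<delta> n * m}"])
        fix x assume x: "x \<in> {\<delta> n * m..\<delta> n * Suc m} - {\<delta> n * m}"
        then have "\<lceil>x / \<delta> n\<rceil> = int (Suc m)"
          using \<delta>[of n] by (intro ceiling_unique) (auto simp: field_simps)
        then show "f (r n x) = f (\<delta> n * Suc m)" by (simp add: r_def)
      next
        have "measure lborel {\<delta> n * m..\<delta> n * Suc m} = \<delta> n"
          using \<delta>[of n] by (simp add: algebra_simps)
        then show "((\<lambda>x. f (\<delta> n * Suc m)) has_integral \<delta> n * f (\<delta> n * Suc m))
            {\<delta> n * m..\<delta> n * Suc m}"
          using has_integral_const_real[of "f (\<delta> n * Suc m)" "\<delta> n * m" "\<delta> n * Suc m"] by simp
      qed simp
      then show ?case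
        using has_integral_combine[OF _ _ Suc.IH] \<delta>[of n] by simp
    qed
    have intg: "((\<lambda>u. f (r n u)) has_integral T / Suc n * (\<Sum>k<Suc n. f (T / Suc n * Suc k))) {0..T}"
      for n using step[of n "Suc n"] unfolding \<delta>_def
      by (simp add: sum_distrib_left del: sum.lessThan_Suc of_nat_Suc)
    have \<delta>_lim: "\<delta> \<longlonglongrightarrow> 0"
      unfolding \<delta>_def using lim_const_over_n[of T, THEN LIMSEQ_Suc] by simp
    have conv: "(\<lambda>n. f (r n u)) \<longlonglongrightarrow> f u" if u: "u \<in> {0..T}" for u
    proof (rule LIMSEQ_I)
      fix e :: real assume "e > 0"
      then obtain d where d: "d > 0" "\<And>x. x > u \<Longrightarrow> dist x u < d \<Longrightarrow> dist (f x) (f u) < e"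
        using cont[OF u] unfolding continuous_within_eps_delta by (metis greaterThan_iff)
      obtain N where N: "\<And>n. n \<ge> N \<Longrightarrow> \<delta> n < d"
        using \<delta>_lim \<open>d > 0\<close> \<delta> unfolding LIMSEQ_iff by (metis abs_of_pos diff_zero real_norm_def)
      have "norm (f (r n u) - f u) < e" if "n \<ge> N" for n
      \<comment> \<open>\<open>at_right\<close> controls only points strictly to the right of
        \<open>u\<close>, but \<open>u\<close> may itself be a grid point.\<close>
      proof (cases "r n u = u")
        case True
        then show ?thesis using \<open>e > 0\<close> by simp
      next
        case False
        then show ?thesis using d(2)[of "r n u"] r_ge[of u n] r_less[of n u] N[OF that]
          by (auto simp: dist_real_def)
      qed
      then show "\<exists>no. \<forall>n\<ge>no. norm (f (r n u) - f u) < e" by blast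
    qed
    have bd: "norm (f (r n u)) \<le> B" if "u \<in> {0..T}" for n u
      using bound[of "r n u"] r_ge[of u n] r_le[of u n] that by auto
    have B: "(\<lambda>_. B) integrable_on {0..T}" by (rule integrable_const_ivl)
    have i: "(\<lambda>u. f (r n u)) integrable_on {0..T}" for n using intg by blast
    have "f integrable_on {0..T}"
      by (rule dominated_convergence(1)[OF i B bd conv])
    moreover have "(\<lambda>n. integral {0..T} (\<lambda>u. f (r n u))) \<longlonglongrightarrow> integral {0..T} f"
      by (rule dominated_convergence(2)[OF i B bd conv])
    ultimately show ?thesis
      using integral_unique[OF intg] by simp
  qed
  then show "f integrable_on {0..T}"
    and "(\<lambda>n. T / Suc n * (\<Sum>k<Suc n. f (T / Suc n * Suc k))) \<longlonglongrightarrow> integral {0..T} f" by auto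
qed

lemma sum_states: "sum f states = f (-1) + f 1"
  by (simp add: states_def)

section \<open>Exponential moments of the flip chain\<close>

locale flip_chain = prob_space M for M :: "'a measure" +
  fixes rate s\<^sub>0 :: real and \<xi> :: "real \<Rightarrow> 'a \<Rightarrow> real" and p :: "real \<Rightarrow> real \<Rightarrow> real \<Rightarrow> real"
  assumes rate: "rate > 0"
    and start: "s\<^sub>0 \<in> states" "AE \<omega> in M. \<xi> 0 \<omega> = s\<^sub>0"
    and meas [measurable]: "\<And>t. t \<ge> 0 \<Longrightarrow> \<xi> t \<in> borel_measurable M"
    and in_states: "\<And>t \<omega>. \<omega> \<in> space M \<Longrightarrow> t \<ge> 0 \<Longrightarrow> \<xi> t \<omega> \<in> states"
    and right_cont: "\<And>t \<omega>. \<omega> \<in> space M \<Longrightarrow> t \<ge> 0 \<Longrightarrow> continuous (at_right t) (\<lambda>u. \<xi> u \<omega>)"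
    and p_0: "\<And>i j. i \<in> states \<Longrightarrow> j \<in> states \<Longrightarrow> p 0 i j = (if i = j then 1 else 0)"
    and p_deriv: "\<And>i j. i \<in> states \<Longrightarrow> j \<in> states \<Longrightarrow>
      ((\<lambda>t. p t i j) has_real_derivative flip_generator rate i j) (at 0 within {0..})"
    and cond_exp: "\<And>s t j. s \<ge> 0 \<Longrightarrow> t \<ge> 0 \<Longrightarrow> j \<in> states \<Longrightarrow> AE \<omega> in M.
      real_cond_exp M (natural_filtration M \<xi> (ennreal s))
        (indicator {\<omega>\<in>space M. \<xi> (s + t) \<omega> = j}) \<omega> = p t (\<xi> s \<omega>) j"

text \<open>In \<open>markov_chain\<close> the semigroup is hidden under an existential quantifier;
  choosing a witness makes it available as the locale parameter \<open>p\<close>.\<close>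

lemma flip_chain_fromD:
  assumes "flip_chain_from rate s M \<xi>" "rate > 0" "s \<in> states"
  obtains p where "flip_chain M rate s \<xi> p"
proof -
  have mc: "markov_chain M states (flip_generator rate) \<xi>" and s: "AE \<omega> in M. \<xi> 0 \<omega> = s"
    using assms by (auto simp: flip_chain_from_def)
  then interpret prob_space M by (simp add: markov_chain_def)
  from mc obtain p where "transition_semigroup states p"
    "infinitesimal_generator states p (flip_generator rate)"
    "\<forall>s\<ge>0. \<forall>t\<ge>0. \<forall>j\<in>states. AE \<omega> in M.
      real_cond_exp M (natural_filtration M \<xi> (ennreal s))
        (indicator {\<omega>\<in>space M. \<xi> (s + t) \<omega> = j}) \<omega> = p t (\<xi> s \<omega>) j"
    unfolding markov_chain_def by blast
  with mc s assms(2,3) have "flip_chain M rate s \<xi> p"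
    by unfold_locales
      (auto simp: markov_chain_def transition_semigroup_def infinitesimal_generator_def)
  then show ?thesis by (rule that)
qed

lemma integrable_bounded_measurable:
  fixes f :: "'a \<Rightarrow> real"
  assumes "finite_measure M" "f \<in> borel_measurable M" "\<And>\<omega>. \<omega> \<in> space M \<Longrightarrow> \<bar>f \<omega>\<bar> \<le> B"
  shows "integrable M f"
  using assms by (intro finite_measure.integrable_const_bound[where B = B]) auto

section \<open>The Markov property tested against bounded functions of the past\<close>

context flip_chain
begin

abbreviation "\<F> t \<equiv> natural_filtration M \<xi> (ennreal t)"

lemma space_filtration [simp]: "space (\<F> t) = space M"
  unfolding natural_filtration_def by (rule space_measure_of) auto

lemma sets_filtration:
  "sets (\<F> t) = sigma_sets (space M)
    {\<xi> u -` B \<inter> space M | u B. 0 \<le> u \<and> ennreal u \<le> ennreal t \<and> B \<in> sets borel}"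
  unfolding natural_filtration_def by (rule sets_measure_of) auto

lemma subalgebra_filtration: "subalgebra M (\<F> t)"
  unfolding subalgebra_def sets_filtration
  by (auto intro!: sets.sigma_sets_subset intro: measurable_sets[OF meas])

lemma measurable_filtration:
  assumes "0 \<le> u" "u \<le> t"
  shows "\<xi> u \<in> borel_measurable (\<F> t)"
proof (rule measurableI)
  fix B :: "real set" assume "B \<in> sets borel"
  then show "\<xi> u -` B \<inter> space (\<F> t) \<in> sets (\<F> t)"
    using assms unfolding sets_filtration space_filtration
    by (intro sigma_sets.Basic) (auto intro: ennreal_leI)
qed simp

lemma abs_chain: "\<omega> \<in> space M \<Longrightarrow> t \<ge> 0 \<Longrightarrow> \<bar>\<xi> t \<omega>\<bar> = 1"
  using in_states[of \<omega> t] by (auto simp: states_def)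

text \<open>With two states, \<open>f (\<xi> (s + t) \<omega>)\<close> is a linear combination of
  the indicators of the states, for which the conditional expectation is known. The weight
  \<open>G\<close> is measurable at time \<open>s\<close>, so it passes through the conditional
  expectation; its boundedness supplies integrability.\<close>

lemma markov_property:
  fixes f :: "real \<Rightarrow> real" and G :: "'a \<Rightarrow> real"
  assumes s: "s \<ge> 0" and t: "t \<ge> 0" and G: "G \<in> borel_measurable (\<F> s)"
    and bound: "\<And>\<omega>. \<omega> \<in> space M \<Longrightarrow> \<bar>G \<omega>\<bar> \<le> B"
  shows "(\<integral>\<omega>. G \<omega> * f (\<xi> (s + t) \<omega>) \<partial>M) =
    (\<integral>\<omega>. G \<omega> * (\<Sum>j\<in>states. p t (\<xi> s \<omega>) j * f j) \<partial>M)"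
proof -
  interpret fs: finite_measure_subalgebra M "\<F> s"
    by unfold_locales (rule subalgebra_filtration)
  have [measurable]: "G \<in> borel_measurable M"
    by (rule measurable_from_subalg[OF subalgebra_filtration G])
  define I :: "real \<Rightarrow> 'a \<Rightarrow> real" where "I j = indicator {\<omega>\<in>space M. \<xi> (s + t) \<omega> = j}" for j
  have set: "{\<omega>\<in>space M. \<xi> u \<omega> = j} \<in> sets M" if "u \<ge> 0" for u j
    using measurable_sets[OF meas[OF that], of "{j}"] by (simp add: vimage_def Int_def conj_commute)
  then have I [measurable]: "I j \<in> borel_measurable M" for j
    using s t by (simp add: I_def)
  have fin: "finite states" by (simp add: states_def)
  have int: "integrable M (\<lambda>\<omega>. G \<omega> * I j \<omega>)" for j
  proof (rule integrable_bounded_measurable[where B = B])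
    fix \<omega> assume "\<omega> \<in> space M"
    with bound[OF this] show "\<bar>G \<omega> * I j \<omega>\<bar> \<le> B"
      by (auto simp: I_def indicator_def)
  qed (auto intro: finite_measure_axioms)
  have *: "(\<integral>\<omega>. G \<omega> * I j \<omega> \<partial>M) = (\<integral>\<omega>. G \<omega> * p t (\<xi> s \<omega>) j \<partial>M) \<and>
    integrable M (\<lambda>\<omega>. G \<omega> * p t (\<xi> s \<omega>) j)" if j: "j \<in> states" for j
  proof -
    have ae: "AE \<omega> in M. G \<omega> * real_cond_exp M (\<F> s) (I j) \<omega> = G \<omega> * p t (\<xi> s \<omega>) j"
      using cond_exp[OF s t j] unfolding I_def by eventually_elim simp
    \<comment> \<open>Nothing is assumed about \<open>p t\<close> as a function of a real argument;
      since the chain takes two values, the composition is a combination of indicators and hence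
      measurable.\<close>
    have pm: "(\<lambda>\<omega>. p t (\<xi> s \<omega>) j) \<in> borel_measurable M"
    proof -
      have "(\<lambda>\<omega>. \<Sum>i\<in>states. indicator {\<omega>\<in>space M. \<xi> s \<omega> = i} \<omega> * p t i j) \<in> borel_measurable M"
        using set[OF s] by measurable
      moreover have "p t (\<xi> s \<omega>) j = (\<Sum>i\<in>states. indicator {\<omega>\<in>space M. \<xi> s \<omega> = i} \<omega> * p t i j)"
        if "\<omega> \<in> space M" for \<omega>
        using in_states[OF that s] that unfolding sum_states by (auto simp: states_def)
      ultimately show ?thesis by (subst measurable_cong)
    qed
    have "(\<integral>\<omega>. G \<omega> * I j \<omega> \<partial>M) = (\<integral>\<omega>. G \<omega> * real_cond_exp M (\<F> s) (I j) \<omega> \<partial>M)"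
      by (rule fs.real_cond_exp_intg(2)[OF int G I, symmetric])
    also have "\<dots> = (\<integral>\<omega>. G \<omega> * p t (\<xi> s \<omega>) j \<partial>M)"
      using ae pm by (intro integral_cong_AE) auto
    finally have 1: "(\<integral>\<omega>. G \<omega> * I j \<omega> \<partial>M) = (\<integral>\<omega>. G \<omega> * p t (\<xi> s \<omega>) j \<partial>M)" .
    have "(\<lambda>\<omega>. G \<omega> * real_cond_exp M (\<F> s) (I j) \<omega>) \<in> borel_measurable M"
      "(\<lambda>\<omega>. G \<omega> * p t (\<xi> s \<omega>) j) \<in> borel_measurable M"
      using pm by measurable
    from integrable_cong_AE[OF this ae] fs.real_cond_exp_intg(1)[OF int G I]
    have "integrable M (\<lambda>\<omega>. G \<omega> * p t (\<xi> s \<omega>) j)" by blast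
    with 1 show ?thesis by simp
  qed
  have "f (\<xi> (s + t) \<omega>) = (\<Sum>j\<in>states. I j \<omega> * f j)" if "\<omega> \<in> space M" for \<omega>
    using in_states[of \<omega> "s + t"] that s t unfolding sum_states by (auto simp: states_def I_def)
  then have "(\<integral>\<omega>. G \<omega> * f (\<xi> (s + t) \<omega>) \<partial>M) = (\<integral>\<omega>. (\<Sum>j\<in>states. f j * (G \<omega> * I j \<omega>)) \<partial>M)"
    by (intro Bochner_Integration.integral_cong) (simp_all add: sum_distrib_left mult_ac)
  also have "\<dots> = (\<Sum>j\<in>states. f j * (\<integral>\<omega>. G \<omega> * I j \<omega> \<partial>M))"
    using int by simp
  also have "\<dots> = (\<Sum>j\<in>states. f j * (\<integral>\<omega>. G \<omega> * p t (\<xi> s \<omega>) j \<partial>M))"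
    using * by simp
  also have "\<dots> = (\<integral>\<omega>. (\<Sum>j\<in>states. f j * (G \<omega> * p t (\<xi> s \<omega>) j)) \<partial>M)"
    using * by (subst Bochner_Integration.integral_sum) auto
  also have "\<dots> = (\<integral>\<omega>. G \<omega> * (\<Sum>j\<in>states. p t (\<xi> s \<omega>) j * f j) \<partial>M)"
    by (simp add: sum_distrib_left mult_ac)
  finally show ?thesis .
qed

end

section \<open>The exponential growth rate of the moments\<close>

definition growth :: "real \<Rightarrow> real \<Rightarrow> real" where
  "growth l \<theta> = sqrt (\<theta>\<^sup>2 + l\<^sup>2) - l"

text \<open>This is the characteristic equation of the 2 by 2 matrix formed by the generator with
  rate \<open>l\<close> plus the diagonal matrix with entries \<open>- \<theta>\<close> and
  \<open>\<theta>\<close>; \<open>growth l \<theta>\<close> is its larger root.\<close>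

lemma growth_square: "(growth l \<theta>)\<^sup>2 = \<theta>\<^sup>2 - 2 * l * growth l \<theta>"
  by (simp add: growth_def power2_diff) (simp add: algebra_simps power2_eq_square)

lemma growth_pos: "\<theta> > 0 \<Longrightarrow> l > 0 \<Longrightarrow> growth l \<theta> > 0"
  unfolding growth_def by (simp add: real_less_rsqrt)

text \<open>This strict bound is what keeps \<open>eigvec\<close> positive at the state -1.\<close>

lemma growth_less:
  assumes "\<theta> > 0" "l > 0"
  shows "growth l \<theta> < \<theta>"
proof -
  have "sqrt (\<theta>\<^sup>2 + l\<^sup>2) < \<theta> + l"
    using assms by (intro real_less_lsqrt) (simp_all add: power2_sum)
  then show ?thesis by (simp add: growth_def)
qed

text \<open>An instance of strict convexity of \<open>growth l\<close>, which vanishes at 0. It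
  makes the square root of the critically discounted price decay in mean, although the mean of that
  price itself does not decay.\<close>

lemma growth_half:
  assumes "\<theta> > 0" "l > 0"
  shows "growth l (\<theta> / 2) < growth l \<theta> / 2"
proof -
  define r where "r = sqrt (\<theta>\<^sup>2 + l\<^sup>2)"
  have r: "r\<^sup>2 = \<theta>\<^sup>2 + l\<^sup>2" "l < r"
    using assms by (simp_all add: r_def real_less_rsqrt)
  \<comment> \<open>After squaring, and with \<open>r\<^sup>2\<close> replaced by its value, the
    claim reduces to this inequality.\<close>
  have "l * l < l * r" using r assms by simp
  then have "(\<theta> / 2)\<^sup>2 + l\<^sup>2 < ((r + l) / 2)\<^sup>2"
    using r(1) by (simp add: power2_eq_square field_simps)
  then have "sqrt ((\<theta> / 2)\<^sup>2 + l\<^sup>2) < (r + l) / 2"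
    using r assms by (intro real_less_lsqrt) simp_all
  then show ?thesis by (simp add: growth_def r_def[symmetric] field_simps)
qed

section \<open>The time integral of the chain\<close>

context flip_chain
begin

text \<open>For \<open>t \<ge> 0\<close> this is the time spent in state 1 minus the time spent in
  state -1 up to \<open>t\<close>.\<close>

definition occ :: "real \<Rightarrow> 'a \<Rightarrow> real" where
  "occ t \<omega> = integral {0..t} (\<lambda>u. \<xi> u \<omega>)"

lemma chain_integrable:
  assumes "\<omega> \<in> space M" "0 \<le> s"
  shows "(\<lambda>u. \<xi> u \<omega>) integrable_on {s..t}"
proof (cases "s \<le> t")
  case True
  have "(\<lambda>u. \<xi> u \<omega>) integrable_on {0..t}"
    using assms True abs_chain right_cont
    by (intro right_riemann_sums_tendsto(1)[where B = 1]) auto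
  then show ?thesis
    by (rule integrable_on_subinterval) (use assms in auto)
qed auto

lemma riemann_occ:
  assumes "\<omega> \<in> space M" "0 \<le> t"
  shows "(\<lambda>n. t / Suc n * (\<Sum>k<Suc n. \<xi> (t / Suc n * Suc k) \<omega>)) \<longlonglongrightarrow> occ t \<omega>"
  unfolding occ_def using assms abs_chain right_cont
  by (intro right_riemann_sums_tendsto(2)[where B = 1 and f = "\<lambda>u. \<xi> u \<omega>"]) auto

text \<open>The integral is taken path by path, so measurability in \<open>\<omega>\<close> comes
  from the Riemann sums, which are finite combinations of the variables
  \<open>\<xi> u\<close>.\<close>

lemma measurable_occ [measurable]:
  assumes "0 \<le> t"
  shows "occ t \<in> borel_measurable M"
proof (rule borel_measurable_LIMSEQ_real[OF riemann_occ[OF _ assms]])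
  fix n show "(\<lambda>\<omega>. t / Suc n * (\<Sum>k<Suc n. \<xi> (t / Suc n * Suc k) \<omega>)) \<in> borel_measurable M"
    using assms by (intro borel_measurable_times borel_measurable_sum meas) auto
qed

text \<open>The integrand has absolute value 1. This bounds the exponents below and later compares
  the price at an arbitrary time with the price at the preceding integer.\<close>

lemma occ_lipschitz:
  assumes "\<omega> \<in> space M" "0 \<le> s" "s \<le> t"
  shows "\<bar>occ t \<omega> - occ s \<omega>\<bar> \<le> t - s"
proof -
  have "integral {0..s} (\<lambda>u. \<xi> u \<omega>) + integral {s..t} (\<lambda>u. \<xi> u \<omega>) = integral {0..t} (\<lambda>u. \<xi> u \<omega>)"
    using assms chain_integrable[OF assms(1)]
    by (intro Henstock_Kurzweil_Integration.integral_combine) auto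
  then have "occ t \<omega> - occ s \<omega> = integral {s..t} (\<lambda>u. \<xi> u \<omega>)"
    by (simp add: occ_def)
  also have "norm \<dots> \<le> integral {s..t} (\<lambda>_. 1)"
    using assms abs_chain[OF assms(1)] chain_integrable[OF assms(1,2)]
    by (intro integral_norm_bound_integral) auto
  also have "\<dots> = t - s" using assms by simp
  finally show ?thesis by simp
qed

lemma abs_occ_le: "\<omega> \<in> space M \<Longrightarrow> 0 \<le> t \<Longrightarrow> \<bar>occ t \<omega>\<bar> \<le> t"
  using occ_lipschitz[of \<omega> 0 t] by (simp add: occ_def)

lemma integrable_exp_occ:
  assumes "t \<ge> 0" "\<theta> \<ge> 0"
  shows "integrable M (\<lambda>\<omega>. exp (\<theta> * occ t \<omega>))"
proof (rule integrable_bounded_measurable[where B = "exp (\<theta> * t)"])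
  fix \<omega> assume "\<omega> \<in> space M"
  with abs_occ_le[OF this assms(1)] assms show "\<bar>exp (\<theta> * occ t \<omega>)\<bar> \<le> exp (\<theta> * t)"
    by (simp add: mult_left_mono)
qed (use assms in \<open>auto intro: finite_measure_axioms\<close>)

section \<open>The Feynman-Kac recursion along a grid\<close>

text \<open>The vector \<open>h x = \<theta> + \<kappa> x\<close> with \<open>\<kappa> = growth rate \<theta>\<close> is the positive eigenvector of the
  Feynman--Kac operator \<open>flip_generator rate + \<theta> x\<close>, so \<open>h (\<xi> t) exp (\<theta> occ t - \<kappa> t)\<close> has
  constant expectation.\<close>

definition eigvec :: "real \<Rightarrow> real \<Rightarrow> real" where
  "eigvec \<theta> x = \<theta> + growth rate \<theta> * x"

lemma eigvec_bounds:
  assumes "\<theta> > 0" "x \<in> states"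
  shows "\<theta> - growth rate \<theta> \<le> eigvec \<theta> x" "eigvec \<theta> x \<le> \<theta> + growth rate \<theta>" "eigvec \<theta> x > 0"
  using growth_pos[OF assms(1) rate] growth_less[OF assms(1) rate] assms(2)
  by (auto simp: eigvec_def states_def)

text \<open>The Feynman-Kac step over one grid cell applied to \<open>eigvec \<theta>\<close>. The
  exponential uses the state at the end of the cell, in accordance with right Riemann sums.\<close>

definition one_step :: "real \<Rightarrow> real \<Rightarrow> real \<Rightarrow> real" where
  "one_step \<theta> \<delta> x = (\<Sum>j\<in>states. p \<delta> x j * (exp (\<theta> * \<delta> * j) * eigvec \<theta> j))"

text \<open>Differentiating the transition probabilities produces the generator, and differentiating
  the exponential produces the potential \<open>\<theta> * x\<close>; \<open>eigvec \<theta>\<close>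
  is an eigenvector of their sum, by \<open>growth_square\<close>.\<close>

lemma one_step_deriv:
  assumes "x \<in> states"
  shows "((\<lambda>\<delta>. one_step \<theta> \<delta> x) has_real_derivative growth rate \<theta> * eigvec \<theta> x) (at 0 within {0..})"
proof -
  have "((\<lambda>\<delta>. one_step \<theta> \<delta> x) has_real_derivative
      (\<Sum>j\<in>states. flip_generator rate x j * eigvec \<theta> j + p 0 x j * (\<theta> * j * eigvec \<theta> j)))
      (at 0 within {0..})"
    unfolding one_step_def
    by (rule DERIV_sum) (auto intro!: derivative_eq_intros p_deriv assms)
  also have "(\<Sum>j\<in>states. flip_generator rate x j * eigvec \<theta> j + p 0 x j * (\<theta> * j * eigvec \<theta> j))
      = growth rate \<theta> * eigvec \<theta> x"
    using assms growth_square[of rate \<theta>]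
    by (auto simp: states_def flip_generator_def p_0 eigvec_def power2_eq_square algebra_simps)
  finally show ?thesis .
qed

text \<open>The derivative at 0 becomes a multiplicative sandwich. The error is measured in
  multiples of the positive number \<open>eigvec \<theta> x\<close>, so that the bounds can be
  iterated, and finiteness of \<open>states\<close> allows one \<open>d\<close> for all
  states.\<close>

lemma one_step_bounds:
  assumes "\<theta> > 0" "\<epsilon> > 0"
  shows "\<exists>d>0. \<forall>\<delta>. 0 \<le> \<delta> \<longrightarrow> \<delta> < d \<longrightarrow> (\<forall>x\<in>states.
    (1 + (growth rate \<theta> - \<epsilon>) * \<delta>) * eigvec \<theta> x \<le> one_step \<theta> \<delta> x \<and>
    one_step \<theta> \<delta> x \<le> (1 + (growth rate \<theta> + \<epsilon>) * \<delta>) * eigvec \<theta> x)"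
proof -
  have z: "one_step \<theta> 0 x = eigvec \<theta> x" if "x \<in> states" for x
    using that by (auto simp: one_step_def p_0 states_def)
  have "\<forall>\<^sub>F \<delta> in at 0 within {0..}.
      dist ((one_step \<theta> \<delta> x - one_step \<theta> 0 x) / (\<delta> - 0)) (growth rate \<theta> * eigvec \<theta> x) < \<epsilon> * eigvec \<theta> x"
    if "x \<in> states" for x
    using one_step_deriv[OF that] eigvec_bounds(3)[OF assms(1) that] assms(2)
    unfolding has_field_derivative_iff by (intro tendstoD) auto
  then have "\<forall>\<^sub>F \<delta> in at 0 within {0..}. \<forall>x\<in>states.
      dist ((one_step \<theta> \<delta> x - one_step \<theta> 0 x) / (\<delta> - 0)) (growth rate \<theta> * eigvec \<theta> x) < \<epsilon> * eigvec \<theta> x"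
    by (intro eventually_ball_finite) (auto simp: states_def)
  then obtain d where d: "d > 0" and *: "\<And>\<delta> x. \<delta> \<ge> 0 \<Longrightarrow> \<delta> \<noteq> 0 \<Longrightarrow> \<delta> < d \<Longrightarrow> x \<in> states \<Longrightarrow>
      dist ((one_step \<theta> \<delta> x - one_step \<theta> 0 x) / (\<delta> - 0)) (growth rate \<theta> * eigvec \<theta> x) < \<epsilon> * eigvec \<theta> x"
    unfolding eventually_at by (auto simp: dist_real_def)
  have "(1 + (growth rate \<theta> - \<epsilon>) * \<delta>) * eigvec \<theta> x \<le> one_step \<theta> \<delta> x \<and>
    one_step \<theta> \<delta> x \<le> (1 + (growth rate \<theta> + \<epsilon>) * \<delta>) * eigvec \<theta> x"
    if "0 \<le> \<delta>" "\<delta> < d" "x \<in> states" for \<delta> x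
  proof (cases "\<delta> = 0")
    case True
    then show ?thesis using z that by simp
  next
    case False
    then have "\<delta> > 0" using that by simp
    have "dist ((one_step \<theta> \<delta> x - eigvec \<theta> x) / \<delta>) (growth rate \<theta> * eigvec \<theta> x) < \<epsilon> * eigvec \<theta> x"
      using *[of \<delta> x] False that z by simp
    then have "(growth rate \<theta> - \<epsilon>) * eigvec \<theta> x \<le> (one_step \<theta> \<delta> x - eigvec \<theta> x) / \<delta> \<and>
        (one_step \<theta> \<delta> x - eigvec \<theta> x) / \<delta> \<le> (growth rate \<theta> + \<epsilon>) * eigvec \<theta> x"
      unfolding dist_real_def left_diff_distrib distrib_right by linarith
    then show ?thesis
      using \<open>\<delta> > 0\<close> by (simp add: field_simps)
  qed
  with d show ?thesis by blast
qed

text \<open>Conditioning at the last but one grid time turns the last factor into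
  \<open>one_step\<close>, so each step multiplies \<open>W\<close> by a factor between
  \<open>c\<close> and \<open>C\<close>.\<close>

lemma discrete_feynman_kac:
  assumes \<theta>: "\<theta> > 0" and \<delta>: "\<delta> \<ge> 0" and c: "c \<ge> 0"
    and lower: "\<And>x. x \<in> states \<Longrightarrow> c * eigvec \<theta> x \<le> one_step \<theta> \<delta> x"
    and upper: "\<And>x. x \<in> states \<Longrightarrow> one_step \<theta> \<delta> x \<le> C * eigvec \<theta> x"
  defines "W \<equiv> \<lambda>k. \<integral>\<omega>. exp (\<theta> * (\<delta> * (\<Sum>j<k. \<xi> (\<delta> * Suc j) \<omega>))) * eigvec \<theta> (\<xi> (\<delta> * k) \<omega>) \<partial>M"
  shows "c ^ k * eigvec \<theta> s\<^sub>0 \<le> W k \<and> W k \<le> C ^ k * eigvec \<theta> s\<^sub>0"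
proof (induction k)
  case 0
  have "W 0 = (\<integral>\<omega>. eigvec \<theta> s\<^sub>0 \<partial>M)"
    unfolding W_def using start(2)
    by (intro integral_cong_AE) (auto simp: eigvec_def)
  then show ?case by (simp add: prob_space)
next
  case (Suc k)
  define G where "G \<omega> = exp (\<theta> * (\<delta> * (\<Sum>j<k. \<xi> (\<delta> * Suc j) \<omega>)))" for \<omega>
  have GF: "G \<in> borel_measurable (\<F> (\<delta> * k))"
    unfolding G_def using \<delta>
    by (intro borel_measurable_exp[THEN measurable_compose] measurable_compose[OF _ borel_measurable_exp]
        borel_measurable_times borel_measurable_sum borel_measurable_const measurable_filtration)
      (auto intro!: mult_left_mono simp del: of_nat_Suc)
  then have GM [measurable]: "G \<in> borel_measurable M"
    by (rule measurable_from_subalg[OF subalgebra_filtration])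
  have Gb: "\<bar>G \<omega>\<bar> \<le> exp (\<theta> * (\<delta> * k))" if "\<omega> \<in> space M" for \<omega>
  proof -
    have "\<xi> (\<delta> * Suc j) \<omega> \<le> 1" for j
      using abs_chain[OF that, of "\<delta> * Suc j"] \<delta> by (simp del: of_nat_Suc)
    then have "(\<Sum>j<k. \<xi> (\<delta> * Suc j) \<omega>) \<le> k"
      using sum_bounded_above[of "{..<k}" "\<lambda>j. \<xi> (\<delta> * Suc j) \<omega>" 1] by simp
    then show ?thesis using \<theta> \<delta> by (simp add: G_def mult_left_mono)
  qed
  define E where "E = (\<integral>\<omega>. G \<omega> * one_step \<theta> \<delta> (\<xi> (\<delta> * k) \<omega>) \<partial>M)"
  \<comment> \<open>The last summand of the exponent and the eigenvector factor depend only on the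
    state at the new grid time; all earlier summands are collected in \<open>G\<close>.\<close>
  have "\<delta> * Suc k = \<delta> * k + \<delta>" by (simp add: algebra_simps)
  then have "W (Suc k) = (\<integral>\<omega>. G \<omega> * (\<lambda>x. exp (\<theta> * \<delta> * x) * eigvec \<theta> x) (\<xi> (\<delta> * k + \<delta>) \<omega>) \<partial>M)"
    by (simp add: W_def G_def ring_distribs exp_add mult_ac add_ac)
  also have "\<dots> = E"
    unfolding E_def one_step_def using \<delta>
    by (intro markov_property[OF _ _ GF Gb]) auto
  finally have WE: "W (Suc k) = E" .
  have W: "W k = (\<integral>\<omega>. G \<omega> * eigvec \<theta> (\<xi> (\<delta> * k) \<omega>) \<partial>M)"
    by (simp add: W_def G_def)
  have st: "\<xi> (\<delta> * k) \<omega> \<in> states" if "\<omega> \<in> space M" for \<omega>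
    using in_states[OF that] \<delta> by simp
  have int: "integrable M (\<lambda>\<omega>. G \<omega> * f (\<xi> (\<delta> * k) \<omega>))" for f :: "real \<Rightarrow> real"
  proof (rule integrable_bounded_measurable)
    \<comment> \<open>On two points every \<open>f\<close> agrees with an affine function, which
      settles measurability for arbitrary \<open>f\<close>.\<close>
    have "(\<lambda>\<omega>. G \<omega> * ((f 1 + f (-1)) / 2 + (f 1 - f (-1)) / 2 * \<xi> (\<delta> * k) \<omega>)) \<in> borel_measurable M"
      by measurable (use \<delta> in simp)
    moreover have "f (\<xi> (\<delta> * k) \<omega>) = (f 1 + f (-1)) / 2 + (f 1 - f (-1)) / 2 * \<xi> (\<delta> * k) \<omega>"
      if "\<omega> \<in> space M" for \<omega> using st[OF that] by (auto simp: states_def field_simps)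
    ultimately show "(\<lambda>\<omega>. G \<omega> * f (\<xi> (\<delta> * k) \<omega>)) \<in> borel_measurable M"
      by (subst measurable_cong) simp_all
    fix \<omega> assume "\<omega> \<in> space M"
    then have "\<bar>f (\<xi> (\<delta> * k) \<omega>)\<bar> \<le> \<bar>f 1\<bar> + \<bar>f (-1)\<bar>"
      using st[of \<omega>] by (auto simp: states_def)
    with Gb[OF \<open>\<omega> \<in> space M\<close>]
    show "\<bar>G \<omega> * f (\<xi> (\<delta> * k) \<omega>)\<bar> \<le> exp (\<theta> * (\<delta> * k)) * (\<bar>f 1\<bar> + \<bar>f (-1)\<bar>)"
      by (simp add: abs_mult mult_mono)
  qed (rule finite_measure_axioms)
  have Gpos: "G \<omega> \<ge> 0" for \<omega> by (simp add: G_def)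
  have up: "E \<le> C * W k"
  proof -
    have "E \<le> (\<integral>\<omega>. G \<omega> * (C * eigvec \<theta> (\<xi> (\<delta> * k) \<omega>)) \<partial>M)"
      unfolding E_def using int int[of "\<lambda>x. C * eigvec \<theta> x"] st upper Gpos
      by (intro integral_mono) (auto intro!: mult_left_mono)
    also have "\<dots> = C * W k" unfolding W by (simp add: mult.left_commute)
    finally show ?thesis .
  qed
  have lo: "c * W k \<le> E"
  proof -
    have "c * W k = (\<integral>\<omega>. G \<omega> * (c * eigvec \<theta> (\<xi> (\<delta> * k) \<omega>)) \<partial>M)"
      unfolding W by (simp add: mult.left_commute)
    also have "\<dots> \<le> E"
      unfolding E_def using int int[of "\<lambda>x. c * eigvec \<theta> x"] st lower Gpos
      by (intro integral_mono) (auto intro!: mult_left_mono)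
    finally show ?thesis .
  qed
  \<comment> \<open>Comparing the two bounds at the starting state gives \<open>c \<le> C\<close>,
    hence the sign of \<open>C\<close> required to multiply the upper induction hypothesis.\<close>
  have "c * eigvec \<theta> s\<^sub>0 \<le> C * eigvec \<theta> s\<^sub>0"
    using lower[OF start(1)] upper[OF start(1)] by linarith
  then have C: "C \<ge> 0" using eigvec_bounds(3)[OF \<theta> start(1)] c by simp
  have "c * (c ^ k * eigvec \<theta> s\<^sub>0) \<le> c * W k" "C * W k \<le> C * (C ^ k * eigvec \<theta> s\<^sub>0)"
    using Suc c C by (auto intro!: mult_left_mono)
  with up lo WE show ?case by (simp add: mult_ac)
qed

section \<open>Exact exponential expectation and moment bounds in continuous time\<close>

lemma tendsto_exp_limit_Suc: "(\<lambda>n. (1 + x * (t / Suc n)) ^ Suc n) \<longlonglongrightarrow> exp (x * t)" for x t :: real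
  using tendsto_exp_limit_sequentially[of "x * t", THEN LIMSEQ_Suc] by simp

text \<open>On the grid of mesh \<open>t / Suc n\<close> the recursion bounds the expectation by
  powers tending to \<open>exp ((growth rate \<theta> - \<epsilon>) * t)\<close> and
  \<open>exp ((growth rate \<theta> + \<epsilon>) * t)\<close>, times
  \<open>eigvec \<theta> s\<^sub>0\<close>. First \<open>n\<close> tends to infinity, then
  \<open>\<epsilon>\<close> to 0.\<close>

lemma expectation_eigvec:
  assumes \<theta>: "\<theta> > 0" and t: "t \<ge> 0"
  shows "(\<integral>\<omega>. exp (\<theta> * occ t \<omega>) * eigvec \<theta> (\<xi> t \<omega>) \<partial>M) = exp (growth rate \<theta> * t) * eigvec \<theta> s\<^sub>0"
    (is "?E = _")
proof -
  let ?\<kappa> = "growth rate \<theta>"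
  define \<delta> where "\<delta> n = t / Suc n" for n
  have \<delta>: "\<delta> n \<ge> 0" for n using t by (simp add: \<delta>_def)
  define w where "w n \<omega> = exp (\<theta> * (\<delta> n * (\<Sum>j<Suc n. \<xi> (\<delta> n * Suc j) \<omega>))) * eigvec \<theta> (\<xi> (\<delta> n * Suc n) \<omega>)" for n \<omega>
  \<comment> \<open>The grid ends exactly at \<open>t\<close>, so the eigenvector factor does not
    vary with \<open>n\<close> and only the exponent has to converge.\<close>
  have dt: "\<delta> n * Suc n = t" for n by (simp add: \<delta>_def)
  have lim: "(\<lambda>n. \<integral>\<omega>. w n \<omega> \<partial>M) \<longlonglongrightarrow> ?E"
  proof (rule integral_dominated_convergence[where w = "\<lambda>_. exp (\<theta> * t) * (\<theta> + ?\<kappa>)"])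
    show "AE \<omega> in M. (\<lambda>n. w n \<omega>) \<longlonglongrightarrow> exp (\<theta> * occ t \<omega>) * eigvec \<theta> (\<xi> t \<omega>)"
    proof (rule AE_I2)
      fix \<omega> assume "\<omega> \<in> space M"
      from riemann_occ[OF this t]
      show "(\<lambda>n. w n \<omega>) \<longlonglongrightarrow> exp (\<theta> * occ t \<omega>) * eigvec \<theta> (\<xi> t \<omega>)"
        unfolding w_def dt by (intro tendsto_intros) (simp add: \<delta>_def)
    qed
    show "AE \<omega> in M. norm (w n \<omega>) \<le> exp (\<theta> * t) * (\<theta> + ?\<kappa>)" for n
    proof (rule AE_I2)
      fix \<omega> assume \<omega>: "\<omega> \<in> space M"
      have "\<xi> (\<delta> n * Suc j) \<omega> \<le> 1" for j
        using abs_chain[OF \<omega>, of "\<delta> n * Suc j"] \<delta>[of n] by (simp del: of_nat_Suc)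
      then have "(\<Sum>j<Suc n. \<xi> (\<delta> n * Suc j) \<omega>) \<le> Suc n"
        using sum_bounded_above[of "{..<Suc n}" "\<lambda>j. \<xi> (\<delta> n * Suc j) \<omega>" 1]
        by (simp del: sum.lessThan_Suc)
      then have "\<delta> n * (\<Sum>j<Suc n. \<xi> (\<delta> n * Suc j) \<omega>) \<le> \<delta> n * Suc n"
        by (rule mult_left_mono) (rule \<delta>)
      then have "exp (\<theta> * (\<delta> n * (\<Sum>j<Suc n. \<xi> (\<delta> n * Suc j) \<omega>))) \<le> exp (\<theta> * t)"
        unfolding dt using \<theta> by simp
      moreover have "0 \<le> eigvec \<theta> (\<xi> t \<omega>)" "eigvec \<theta> (\<xi> t \<omega>) \<le> \<theta> + ?\<kappa>"
        using eigvec_bounds[OF \<theta> in_states[OF \<omega> t]] by auto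
      ultimately show "norm (w n \<omega>) \<le> exp (\<theta> * t) * (\<theta> + ?\<kappa>)"
        unfolding w_def dt real_norm_def abs_mult
        by (intro mult_mono) auto
    qed
    show "w n \<in> borel_measurable M" for n
      unfolding w_def eigvec_def using \<delta>[of n]
      by (intro measurable_compose[OF _ borel_measurable_exp]
          borel_measurable_times borel_measurable_add borel_measurable_sum borel_measurable_const meas)
        auto
    show "(\<lambda>\<omega>. exp (\<theta> * occ t \<omega>) * eigvec \<theta> (\<xi> t \<omega>)) \<in> borel_measurable M"
      unfolding eigvec_def using t by measurable
  qed simp
  have \<kappa>: "?\<kappa> > 0" using growth_pos[OF \<theta> rate] .
  \<comment> \<open>The restriction of \<open>\<epsilon>\<close> below the growth rate makes the
    lower factor nonnegative, as \<open>discrete_feynman_kac\<close> demands of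
    \<open>c\<close>.\<close>
  have sandwich: "exp ((?\<kappa> - \<epsilon>) * t) * eigvec \<theta> s\<^sub>0 \<le> ?E \<and> ?E \<le> exp ((?\<kappa> + \<epsilon>) * t) * eigvec \<theta> s\<^sub>0"
    if \<epsilon>: "\<epsilon> > 0" "\<epsilon> < ?\<kappa>" for \<epsilon>
  proof -
    obtain d where d: "d > 0" "\<And>u x. 0 \<le> u \<Longrightarrow> u < d \<Longrightarrow> x \<in> states \<Longrightarrow>
        (1 + (?\<kappa> - \<epsilon>) * u) * eigvec \<theta> x \<le> one_step \<theta> u x \<and>
        one_step \<theta> u x \<le> (1 + (?\<kappa> + \<epsilon>) * u) * eigvec \<theta> x"
      using one_step_bounds[OF \<theta> \<epsilon>(1)] by blast
    have "\<delta> \<longlonglongrightarrow> 0"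
      unfolding \<delta>_def using lim_const_over_n[of t, THEN LIMSEQ_Suc] by simp
    then have "\<forall>\<^sub>F n in sequentially. \<delta> n < d"
      using d(1) by (rule order_tendstoD)
    then have ev: "\<forall>\<^sub>F n in sequentially.
        (1 + (?\<kappa> - \<epsilon>) * \<delta> n) ^ Suc n * eigvec \<theta> s\<^sub>0 \<le> (\<integral>\<omega>. w n \<omega> \<partial>M) \<and>
        (\<integral>\<omega>. w n \<omega> \<partial>M) \<le> (1 + (?\<kappa> + \<epsilon>) * \<delta> n) ^ Suc n * eigvec \<theta> s\<^sub>0"
    proof eventually_elim
      case (elim n)
      show ?case
        unfolding w_def using \<epsilon> d(2)[OF \<delta> elim] \<delta>[of n]
        by (intro discrete_feynman_kac \<theta>) auto
    qed
    have "exp ((?\<kappa> - \<epsilon>) * t) * eigvec \<theta> s\<^sub>0 \<le> ?E"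
      using tendsto_mult_right[OF tendsto_exp_limit_Suc[of "?\<kappa> - \<epsilon>" t], of "eigvec \<theta> s\<^sub>0"] ev lim
      unfolding \<delta>_def by (intro tendsto_le[OF sequentially_bot]) (auto elim: eventually_mono)
    moreover have "?E \<le> exp ((?\<kappa> + \<epsilon>) * t) * eigvec \<theta> s\<^sub>0"
      using tendsto_mult_right[OF tendsto_exp_limit_Suc[of "?\<kappa> + \<epsilon>" t], of "eigvec \<theta> s\<^sub>0"] ev lim
      unfolding \<delta>_def by (intro tendsto_le[OF sequentially_bot]) (auto elim: eventually_mono)
    ultimately show ?thesis by blast
  qed
  have ev: "\<forall>\<^sub>F \<epsilon> in at_right 0. exp ((?\<kappa> - \<epsilon>) * t) * eigvec \<theta> s\<^sub>0 \<le> ?E \<and>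
      ?E \<le> exp ((?\<kappa> + \<epsilon>) * t) * eigvec \<theta> s\<^sub>0"
    using eventually_at_right_less[of "0::real"] order_tendstoD(2)[OF tendsto_ident_at \<kappa>]
    by eventually_elim (rule sandwich)
  have "exp (?\<kappa> * t) * eigvec \<theta> s\<^sub>0 \<le> ?E"
  proof (rule tendsto_upperbound)
    show "((\<lambda>\<epsilon>. exp ((?\<kappa> - \<epsilon>) * t) * eigvec \<theta> s\<^sub>0) \<longlongrightarrow> exp (?\<kappa> * t) * eigvec \<theta> s\<^sub>0) (at_right 0)"
      by (auto intro!: tendsto_eq_intros)
  qed (use ev in \<open>auto elim: eventually_mono\<close>)
  moreover have "?E \<le> exp (?\<kappa> * t) * eigvec \<theta> s\<^sub>0"
  proof (rule tendsto_lowerbound)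
    show "((\<lambda>\<epsilon>. exp ((?\<kappa> + \<epsilon>) * t) * eigvec \<theta> s\<^sub>0) \<longlongrightarrow> exp (?\<kappa> * t) * eigvec \<theta> s\<^sub>0) (at_right 0)"
      by (auto intro!: tendsto_eq_intros)
  qed (use ev in \<open>auto elim: eventually_mono\<close>)
  ultimately show ?thesis by simp
qed

text \<open>The factor \<open>eigvec\<close> lies between the positive constants
  \<open>\<theta> - growth rate \<theta>\<close> and \<open>\<theta> + growth rate \<theta>\<close>,
  so removing it from the exact identity costs only constant factors.\<close>

lemma exp_moment_bounds:
  assumes "\<theta> > 0"
  shows "\<exists>c>0. \<forall>t\<ge>0. c * exp (growth rate \<theta> * t) \<le> (\<integral>\<omega>. exp (\<theta> * occ t \<omega>) \<partial>M)"
    and "\<exists>C>0. \<forall>t\<ge>0. (\<integral>\<omega>. exp (\<theta> * occ t \<omega>) \<partial>M) \<le> C * exp (growth rate \<theta> * t)"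
proof -
  let ?\<kappa> = "growth rate \<theta>" and ?h = "eigvec \<theta> s\<^sub>0"
  have k: "0 < ?\<kappa>" "?\<kappa> < \<theta>" using growth_pos growth_less assms rate by auto
  have h: "?h > 0" using eigvec_bounds(3)[OF assms start(1)] .
  have pos: "?h / (\<theta> + ?\<kappa>) > 0" "?h / (\<theta> - ?\<kappa>) > 0" using k h assms by auto
  have mult: "(\<integral>\<omega>. exp (\<theta> * occ t \<omega>) * b \<partial>M) = (\<integral>\<omega>. exp (\<theta> * occ t \<omega>) \<partial>M) * b" for b t
    by simp
  have int: "integrable M (\<lambda>\<omega>. exp (\<theta> * occ t \<omega>) * eigvec \<theta> (\<xi> t \<omega>))" if t: "t \<ge> 0" for t
  proof (rule Bochner_Integration.integrable_bound)
    show "integrable M (\<lambda>\<omega>. exp (\<theta> * occ t \<omega>) * (\<theta> + ?\<kappa>))"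
      using integrable_exp_occ[OF t, of \<theta>] assms by simp
    show "AE \<omega> in M. norm (exp (\<theta> * occ t \<omega>) * eigvec \<theta> (\<xi> t \<omega>)) \<le> norm (exp (\<theta> * occ t \<omega>) * (\<theta> + ?\<kappa>))"
      using eigvec_bounds(2,3)[OF assms in_states[OF _ t]] k assms
      by (intro AE_I2) (auto simp: abs_mult less_imp_le)
  qed (unfold eigvec_def, use t in measurable)
  have lower: "?h / (\<theta> + ?\<kappa>) * exp (?\<kappa> * t) \<le> (\<integral>\<omega>. exp (\<theta> * occ t \<omega>) \<partial>M)" if t: "t \<ge> 0" for t
  proof -
    have "(\<integral>\<omega>. exp (\<theta> * occ t \<omega>) * eigvec \<theta> (\<xi> t \<omega>) \<partial>M) \<le> (\<integral>\<omega>. exp (\<theta> * occ t \<omega>) * (\<theta> + ?\<kappa>) \<partial>M)"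
      using integrable_exp_occ[OF t, of \<theta>] assms int[OF t] eigvec_bounds(2)[OF assms in_states[OF _ t]]
      by (intro integral_mono) auto
    then show ?thesis
      unfolding expectation_eigvec[OF assms t] mult using k by (simp add: field_simps)
  qed
  have upper: "(\<integral>\<omega>. exp (\<theta> * occ t \<omega>) \<partial>M) \<le> ?h / (\<theta> - ?\<kappa>) * exp (?\<kappa> * t)" if t: "t \<ge> 0" for t
  proof -
    have "(\<integral>\<omega>. exp (\<theta> * occ t \<omega>) * (\<theta> - ?\<kappa>) \<partial>M) \<le> (\<integral>\<omega>. exp (\<theta> * occ t \<omega>) * eigvec \<theta> (\<xi> t \<omega>) \<partial>M)"
      using integrable_exp_occ[OF t, of \<theta>] assms int[OF t] eigvec_bounds(1)[OF assms in_states[OF _ t]]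
      by (intro integral_mono) auto
    then show ?thesis
      unfolding expectation_eigvec[OF assms t] mult using k by (simp add: field_simps)
  qed
  show "\<exists>c>0. \<forall>t\<ge>0. c * exp (?\<kappa> * t) \<le> (\<integral>\<omega>. exp (\<theta> * occ t \<omega>) \<partial>M)"
    using lower pos(1) by blast
  show "\<exists>C>0. \<forall>t\<ge>0. (\<integral>\<omega>. exp (\<theta> * occ t \<omega>) \<partial>M) \<le> C * exp (?\<kappa> * t)"
    using upper pos(2) by blast
qed

section \<open>Discounted exponentials at integer times\<close>

lemma integral_exp_drift_occ:
  "(\<integral>\<omega>. exp (b * t + \<theta> * occ t \<omega>) \<partial>M) = exp (b * t) * (\<integral>\<omega>. exp (\<theta> * occ t \<omega>) \<partial>M)"
  by (simp add: exp_add)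

lemma integrable_exp_drift_occ:
  "t \<ge> 0 \<Longrightarrow> \<theta> \<ge> 0 \<Longrightarrow> integrable M (\<lambda>\<omega>. exp (b * t + \<theta> * occ t \<omega>))"
  using integrable_exp_occ by (simp add: exp_add)

text \<open>The expectations are dominated by a geometric series of ratio
  \<open>exp (b + growth rate \<theta>)\<close>. Applied with \<open>\<theta> = \<sigma>\<close> it
  bounds the supremum of the reward; applied with \<open>\<theta> = \<sigma> / 2\<close> it gives
  almost sure decay at the critical rate.\<close>

lemma nn_integral_suminf_exp_occ:
  assumes "\<theta> > 0" "b + growth rate \<theta> < 0"
  shows "(\<integral>\<^sup>+\<omega>. (\<Sum>n. ennreal (exp (b * real n + \<theta> * occ n \<omega>))) \<partial>M) < \<infinity>"
proof -
  obtain C where C: "C > 0"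
    and upper: "\<And>t. t \<ge> 0 \<Longrightarrow> (\<integral>\<omega>. exp (\<theta> * occ t \<omega>) \<partial>M) \<le> C * exp (growth rate \<theta> * t)"
    using exp_moment_bounds(2)[OF assms(1)] by blast
  define q where "q = exp (b + growth rate \<theta>)"
  have q: "0 < q" "q < 1" using assms(2) by (simp_all add: q_def)
  have le: "(\<integral>\<^sup>+\<omega>. ennreal (exp (b * real n + \<theta> * occ n \<omega>)) \<partial>M) \<le> ennreal (C * q ^ n)" for n
  proof -
    have "(\<integral>\<^sup>+\<omega>. ennreal (exp (b * real n + \<theta> * occ n \<omega>)) \<partial>M)
        = ennreal (\<integral>\<omega>. exp (b * real n + \<theta> * occ n \<omega>) \<partial>M)"
      using assms(1) by (intro nn_integral_eq_integral integrable_exp_drift_occ) auto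
    also have "(\<integral>\<omega>. exp (b * real n + \<theta> * occ n \<omega>) \<partial>M)
        \<le> exp (b * real n) * (C * exp (growth rate \<theta> * real n))"
      unfolding integral_exp_drift_occ using upper[of n] by (intro mult_left_mono) auto
    also have "\<dots> = C * q ^ n"
      by (simp add: q_def exp_of_nat_mult[symmetric] exp_add[symmetric] algebra_simps)
    finally show ?thesis by (simp add: ennreal_leI)
  qed
  have "summable (\<lambda>n. C * q ^ n)"
    using q by (intro summable_mult summable_geometric) auto
  then have fin: "(\<Sum>n. ennreal (C * q ^ n)) < \<infinity>"
    using C q by (subst suminf_ennreal2) auto
  have "(\<integral>\<^sup>+\<omega>. (\<Sum>n. ennreal (exp (b * real n + \<theta> * occ n \<omega>))) \<partial>M)
      = (\<Sum>n. \<integral>\<^sup>+\<omega>. ennreal (exp (b * real n + \<theta> * occ n \<omega>)) \<partial>M)"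
    by (intro nn_integral_suminf) measurable
  also have "\<dots> \<le> (\<Sum>n. ennreal (C * q ^ n))"
    by (intro suminf_le le) auto
  finally show ?thesis using fin by (rule le_less_trans)
qed

end

section \<open>The reward process\<close>

lemma ext_expectation_integrable:
  fixes f :: "'a \<Rightarrow> real"
  assumes "integrable M f"
  shows "ext_expectation M f = ereal (\<integral>\<omega>. f \<omega> \<partial>M)"
proof -
  have "(\<integral>\<^sup>+\<omega>. ennreal (f \<omega>) \<partial>M) < \<infinity>" "(\<integral>\<^sup>+\<omega>. ennreal (- f \<omega>) \<partial>M) < \<infinity>"
    using assms unfolding real_integrable_def by (auto simp: top.not_eq_extremum)
  then show ?thesis
    unfolding ext_expectation_def real_lebesgue_integral_def[OF assms]
    by (cases "\<integral>\<^sup>+\<omega>. ennreal (f \<omega>) \<partial>M"; cases "\<integral>\<^sup>+\<omega>. ennreal (- f \<omega>) \<partial>M")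
      (auto simp: enn2ereal_ennreal)
qed

lemma ennreal_le_suminf: "f n \<le> suminf f" for f :: "nat \<Rightarrow> ennreal"
  using sum_le_suminf[of f "{n}"] by simp

locale switching_price = flip_chain +
  fixes \<mu> \<sigma> a \<rho> y :: real
  assumes \<sigma>: "\<sigma> > 0" and a: "a > 0" and \<rho>: "\<rho> > 0" and y: "y > 0"
begin

abbreviation "X t \<equiv> reward \<mu> \<sigma> a \<rho> \<xi> y (ennreal t)"

lemma reward_eq:
  "t \<ge> 0 \<Longrightarrow> X t \<omega> = y * exp ((\<mu> - \<rho>) * t + \<sigma> * occ t \<omega>) - a * exp (- \<rho> * t)"
  by (simp add: reward_def price_def occ_def exp_add[symmetric] algebra_simps)

lemma measurable_reward [measurable]: "t \<ge> 0 \<Longrightarrow> X t \<in> borel_measurable M"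
  by (subst measurable_cong[OF reward_eq]) auto

lemma discount_cost:
  assumes "t \<ge> 0"
  shows "0 \<le> a * exp (- \<rho> * t)" "a * exp (- \<rho> * t) \<le> a"
  using a \<rho> assms by auto

lemma expectation_reward:
  assumes "t \<ge> 0"
  shows "ext_expectation M (X t) =
    ereal (y * (exp ((\<mu> - \<rho>) * t) * (\<integral>\<omega>. exp (\<sigma> * occ t \<omega>) \<partial>M)) - a * exp (- \<rho> * t))"
proof -
  have "X t = (\<lambda>\<omega>. y * exp ((\<mu> - \<rho>) * t + \<sigma> * occ t \<omega>) - a * exp (- \<rho> * t))"
    using reward_eq[OF assms] by auto
  then show ?thesis
    using integrable_exp_drift_occ[OF assms, of \<sigma> "\<mu> - \<rho>"] \<sigma>
    by (simp add: ext_expectation_integrable integral_exp_drift_occ prob_space)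
qed

text \<open>The expected discounted price lies between positive multiples of
  \<open>exp (\<beta> * t)\<close> and the discounted cost between 0 and \<open>a\<close>. Thus the
  expected rewards are unbounded exactly when \<open>\<beta> > 0\<close>; the critical case
  \<open>\<beta> = 0\<close> is bounded.\<close>

lemma SUP_expectation_reward_iff:
  "(SUP t\<in>{0..}. ext_expectation M (X t)) = \<infinity> \<longleftrightarrow> \<rho> < \<mu> + growth rate \<sigma>"
proof -
  define \<beta> where "\<beta> = \<mu> - \<rho> + growth rate \<sigma>"
  obtain c where c: "c > 0" and
    lower: "\<And>t. t \<ge> 0 \<Longrightarrow> c * exp (growth rate \<sigma> * t) \<le> (\<integral>\<omega>. exp (\<sigma> * occ t \<omega>) \<partial>M)"
    using exp_moment_bounds(1)[OF \<sigma>] by blast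
  obtain C where C: "C > 0" and
    upper: "\<And>t. t \<ge> 0 \<Longrightarrow> (\<integral>\<omega>. exp (\<sigma> * occ t \<omega>) \<partial>M) \<le> C * exp (growth rate \<sigma> * t)"
    using exp_moment_bounds(2)[OF \<sigma>] by blast
  have \<beta>: "exp ((\<mu> - \<rho>) * t) * (b * exp (growth rate \<sigma> * t)) = b * exp (\<beta> * t)" for t b
    by (simp add: \<beta>_def exp_add[symmetric] algebra_simps)
  show ?thesis
  proof
    assume r: "\<rho> < \<mu> + growth rate \<sigma>"
    then have "\<beta> > 0" by (simp add: \<beta>_def)
    show "(SUP t\<in>{0..}. ext_expectation M (X t)) = \<infinity>"
    proof (rule SUP_PInfty)
      fix n :: nat
      \<comment> \<open>Solves \<open>y * c * \<beta> * t = real n + a\<close>. The exponential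
        exceeds its argument, and the extra \<open>a\<close> pays for the discounted cost.\<close>
      define t where "t = (real n + a) / (y * c) / \<beta>"
      have t: "t \<ge> 0" using a y c \<open>\<beta> > 0\<close> by (simp add: t_def)
      have "(real n + a) / (y * c) = \<beta> * t" using \<open>\<beta> > 0\<close> by (simp add: t_def)
      also have "\<dots> \<le> exp (\<beta> * t)" using exp_ge_add_one_self[of "\<beta> * t"] by linarith
      finally have "real n + a \<le> y * (c * exp (\<beta> * t))"
        using y c by (simp add: field_simps)
      also have "\<dots> \<le> y * (exp ((\<mu> - \<rho>) * t) * (\<integral>\<omega>. exp (\<sigma> * occ t \<omega>) \<partial>M))"
        unfolding \<beta>[symmetric] using lower[OF t] y by (intro mult_left_mono) auto
      finally have "ereal (real n) \<le> ext_expectation M (X t)"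
        unfolding expectation_reward[OF t] using discount_cost[OF t] by simp
      with t show "\<exists>t\<in>{0..}. ereal (real n) \<le> ext_expectation M (X t)" by auto
    qed
  next
    assume inf: "(SUP t\<in>{0..}. ext_expectation M (X t)) = \<infinity>"
    show "\<rho> < \<mu> + growth rate \<sigma>"
    proof (rule ccontr)
      assume "\<not> \<rho> < \<mu> + growth rate \<sigma>"
      then have "\<beta> \<le> 0" by (simp add: \<beta>_def)
      have "ext_expectation M (X t) \<le> ereal (y * C)" if t: "t \<ge> 0" for t
      proof -
        have "y * (exp ((\<mu> - \<rho>) * t) * (\<integral>\<omega>. exp (\<sigma> * occ t \<omega>) \<partial>M)) \<le> y * (C * exp (\<beta> * t))"
          unfolding \<beta>[symmetric] using upper[OF t] y by (intro mult_left_mono) auto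
        also have "\<dots> \<le> y * C"
          using y C t \<open>\<beta> \<le> 0\<close> by (simp add: mult_nonpos_nonneg)
        finally show ?thesis
          unfolding expectation_reward[OF t] using discount_cost[OF t] by simp
      qed
      then have "(SUP t\<in>{0..}. ext_expectation M (X t)) \<le> ereal (y * C)"
        by (intro SUP_least) auto
      with inf show False by simp
    qed
  qed
qed

text \<open>Within a unit time interval the logarithm of the discounted price changes by at most
  \<open>K\<close>, so its supremum is controlled by the values at integer times, and these by their
  sum, which has finite expectation.\<close>

lemma reward_sup_finite:
  assumes "\<rho> > \<mu> + growth rate \<sigma>"
  shows "(\<integral>\<^sup>+\<omega>. (SUP t\<in>{0..}. ennreal \<bar>X t \<omega>\<bar>) \<partial>M) < \<infinity>"
proof -
  define b where "b = \<mu> - \<rho>"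
  define K where "K = \<bar>b\<bar> + \<sigma>"
  define D where "D = y * exp K"
  have D: "D \<ge> 0" using y by (simp add: D_def)
  let ?S = "\<lambda>\<omega>. \<Sum>n. ennreal (exp (b * real n + \<sigma> * occ n \<omega>))"
  have "(SUP t\<in>{0..}. ennreal \<bar>X t \<omega>\<bar>) \<le> ennreal a + ennreal D * ?S \<omega>" if \<omega>: "\<omega> \<in> space M" for \<omega>
  proof (rule SUP_least)
    fix t :: real assume "t \<in> {0..}"
    then have t: "t \<ge> 0" by simp
    define n where "n = nat \<lfloor>t\<rfloor>"
    have n: "real n \<le> t" "t \<le> real n + 1" using t unfolding n_def by linarith+
    have "b * (t - n) \<le> \<bar>b\<bar> * (t - n)"
      using n by (intro mult_right_mono) auto
    also have "\<dots> \<le> \<bar>b\<bar> * 1"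
      using n by (intro mult_left_mono) auto
    finally have "b * (t - n) \<le> \<bar>b\<bar>" by simp
    moreover have "occ t \<omega> \<le> occ n \<omega> + 1"
      using occ_lipschitz[OF \<omega> _ n(1)] n by auto
    then have "\<sigma> * occ t \<omega> \<le> \<sigma> * (occ n \<omega> + 1)"
      using \<sigma> by (intro mult_left_mono) auto
    ultimately have "b * t + \<sigma> * occ t \<omega> \<le> K + (b * real n + \<sigma> * occ n \<omega>)"
      by (simp add: K_def algebra_simps)
    then have "exp (b * t + \<sigma> * occ t \<omega>) \<le> exp K * exp (b * real n + \<sigma> * occ n \<omega>)"
      by (simp add: exp_add[symmetric])
    then have "y * exp (b * t + \<sigma> * occ t \<omega>) \<le> y * (exp K * exp (b * real n + \<sigma> * occ n \<omega>))"
      by (rule mult_left_mono) (use y in simp)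
    moreover have "0 \<le> y * exp (b * t + \<sigma> * occ t \<omega>)" using y by simp
    ultimately have "\<bar>X t \<omega>\<bar> \<le> a + D * exp (b * real n + \<sigma> * occ n \<omega>)"
      unfolding reward_eq[OF t] D_def b_def[symmetric] using discount_cost[OF t] by linarith
    then have "ennreal \<bar>X t \<omega>\<bar> \<le> ennreal a + ennreal D * ennreal (exp (b * real n + \<sigma> * occ n \<omega>))"
      using a D by (simp add: ennreal_mult[symmetric] ennreal_plus[symmetric] ennreal_leI del: ennreal_plus)
    moreover have "ennreal (exp (b * real n + \<sigma> * occ n \<omega>)) \<le> ?S \<omega>"
      by (rule ennreal_le_suminf)
    then have "ennreal a + ennreal D * ennreal (exp (b * real n + \<sigma> * occ n \<omega>))
        \<le> ennreal a + ennreal D * ?S \<omega>"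
      by (intro add_left_mono mult_left_mono) auto
    ultimately show "ennreal \<bar>X t \<omega>\<bar> \<le> ennreal a + ennreal D * ?S \<omega>"
      by (rule order_trans)
  qed
  then have "(\<integral>\<^sup>+\<omega>. (SUP t\<in>{0..}. ennreal \<bar>X t \<omega>\<bar>) \<partial>M) \<le> (\<integral>\<^sup>+\<omega>. ennreal a + ennreal D * ?S \<omega> \<partial>M)"
    by (rule nn_integral_mono)
  also have "\<dots> = ennreal a + ennreal D * (\<integral>\<^sup>+\<omega>. ?S \<omega> \<partial>M)"
    by (simp add: nn_integral_add nn_integral_cmult emeasure_space_1)
  also have "\<dots> < \<infinity>"
  proof -
    have "ennreal a + ennreal D * J < \<infinity>" if "J < \<infinity>" for J
      using that by (simp add: ennreal_mult_less_top)
    then show ?thesis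
      by this (rule nn_integral_suminf_exp_occ[OF \<sigma>], use assms in \<open>simp add: b_def\<close>)
  qed
  finally show ?thesis .
qed

text \<open>An integrable supremum would dominate the prices discounted at the critical rate. They
  tend to 0 almost surely while their means stay above a positive constant, against dominated
  convergence.\<close>

lemma reward_sup_infinite:
  assumes "\<rho> \<le> \<mu> + growth rate \<sigma>"
  shows "(\<integral>\<^sup>+\<omega>. (SUP t\<in>{0..}. ennreal \<bar>X t \<omega>\<bar>) \<partial>M) = \<infinity>"
proof (rule ccontr)
  assume "\<not> ?thesis"
  then have fin: "(\<integral>\<^sup>+\<omega>. (SUP t\<in>{0..}. ennreal \<bar>X t \<omega>\<bar>) \<partial>M) < \<infinity>"
    by (simp add: top.not_eq_extremum)
  let ?\<kappa> = "growth rate \<sigma>"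
  \<comment> \<open>The price per unit of \<open>y\<close>, discounted at the critical rate instead
    of \<open>\<rho>\<close>; this can only lower it, because \<open>\<rho>\<close> is at most
    critical. Below, \<open>R\<close> is the square root of \<open>Z\<close>.\<close>
  define Z where "Z n \<omega> = exp (- ?\<kappa> * real n + \<sigma> * occ n \<omega>)" for n \<omega>
  define R where "R n \<omega> = exp (- ?\<kappa> / 2 * real n + \<sigma> / 2 * occ n \<omega>)" for n \<omega>
  \<comment> \<open>Restricting to integer times makes the supremum countable, hence a measurable
    majorant for dominated convergence.\<close>
  define S where "S \<omega> = (SUP n. ennreal \<bar>X (real n) \<omega>\<bar>)" for \<omega>
  have [measurable]: "S \<in> borel_measurable M" "Z n \<in> borel_measurable M" for n
    unfolding S_def Z_def by measurable
  have "(\<integral>\<^sup>+\<omega>. S \<omega> \<partial>M) \<le> (\<integral>\<^sup>+\<omega>. (SUP t\<in>{0..}. ennreal \<bar>X t \<omega>\<bar>) \<partial>M)"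
    unfolding S_def by (intro nn_integral_mono SUP_least SUP_upper2[OF _ order_refl]) auto
  with fin have "(\<integral>\<^sup>+\<omega>. S \<omega> \<partial>M) < \<infinity>" by (rule le_less_trans[rotated])
  then have w: "(\<integral>\<^sup>+\<omega>. S \<omega> + ennreal a \<partial>M) < \<infinity>"
    by (simp add: nn_integral_add emeasure_space_1)
  have le: "ennreal (y * Z n \<omega>) \<le> S \<omega> + ennreal a" for n \<omega>
  proof -
    have "- ?\<kappa> * real n \<le> (\<mu> - \<rho>) * real n"
      using assms by (intro mult_right_mono) auto
    then have "y * Z n \<omega> \<le> y * exp ((\<mu> - \<rho>) * real n + \<sigma> * occ n \<omega>)"
      using y by (simp add: Z_def)
    also have "\<dots> \<le> \<bar>X (real n) \<omega>\<bar> + a"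
      unfolding reward_eq[OF of_nat_0_le_iff] using discount_cost[of "real n"] by linarith
    finally have "ennreal (y * Z n \<omega>) \<le> ennreal \<bar>X (real n) \<omega>\<bar> + ennreal a"
      using a by (simp add: ennreal_plus[symmetric] ennreal_leI del: ennreal_plus)
    also have "ennreal \<bar>X (real n) \<omega>\<bar> \<le> S \<omega>"
      unfolding S_def by (rule SUP_upper) simp
    finally show ?thesis by (simp add: add_right_mono)
  qed
  \<comment> \<open>\<open>growth_half\<close> says precisely that the ratio for \<open>R\<close> is
    below 1. Summability then forces \<open>R\<close>, and so its square \<open>Z\<close>, to 0
    almost surely.\<close>
  have "(\<integral>\<^sup>+\<omega>. (\<Sum>n. ennreal (R n \<omega>)) \<partial>M) < \<infinity>"
    unfolding R_def using \<sigma> growth_half[OF \<sigma> rate] by (intro nn_integral_suminf_exp_occ) auto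
  then have "AE \<omega> in M. (\<Sum>n. ennreal (R n \<omega>)) \<noteq> \<infinity>"
    by (intro nn_integral_noteq_infinite) (auto simp: R_def)
  then have lim: "AE \<omega> in M. (\<lambda>n. ennreal (y * Z n \<omega>)) \<longlonglongrightarrow> 0"
  proof eventually_elim
    case (elim \<omega>)
    then have "summable (\<lambda>n. R n \<omega>)"
      by (intro summable_suminf_not_top) (auto simp: R_def)
    then have "(\<lambda>n. R n \<omega>) \<longlonglongrightarrow> 0" by (rule summable_LIMSEQ_zero)
    then have "(\<lambda>n. y * (R n \<omega>)\<^sup>2) \<longlonglongrightarrow> y * 0\<^sup>2" by (intro tendsto_intros)
    moreover have "(R n \<omega>)\<^sup>2 = Z n \<omega>" for n
      by (simp add: R_def Z_def exp_double[symmetric] algebra_simps)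
    ultimately have "(\<lambda>n. y * Z n \<omega>) \<longlonglongrightarrow> 0" by simp
    then show ?case using tendsto_ennrealI by fastforce
  qed
  have "(\<lambda>n. \<integral>\<^sup>+\<omega>. ennreal (y * Z n \<omega>) \<partial>M) \<longlonglongrightarrow> (\<integral>\<^sup>+\<omega>. 0 \<partial>M)"
    by (rule nn_integral_dominated_convergence[where w = "\<lambda>\<omega>. S \<omega> + ennreal a"])
      (use w le lim in auto)
  then have to0: "(\<lambda>n. \<integral>\<^sup>+\<omega>. ennreal (y * Z n \<omega>) \<partial>M) \<longlonglongrightarrow> 0" by simp
  obtain c where c: "c > 0"
    "\<And>t. t \<ge> 0 \<Longrightarrow> c * exp (?\<kappa> * t) \<le> (\<integral>\<omega>. exp (\<sigma> * occ t \<omega>) \<partial>M)"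
    using exp_moment_bounds(1)[OF \<sigma>] by blast
  have ge: "ennreal (y * c) \<le> (\<integral>\<^sup>+\<omega>. ennreal (y * Z n \<omega>) \<partial>M)" for n
  proof -
    have "c = exp (- ?\<kappa> * real n) * (c * exp (?\<kappa> * real n))"
      by (simp add: exp_minus)
    also have "\<dots> \<le> (\<integral>\<omega>. Z n \<omega> \<partial>M)"
      unfolding Z_def integral_exp_drift_occ using c(2)[of n] by (intro mult_left_mono) auto
    finally have "y * c \<le> (\<integral>\<omega>. y * Z n \<omega> \<partial>M)" using y by simp
    then have "ennreal (y * c) \<le> ennreal (\<integral>\<omega>. y * Z n \<omega> \<partial>M)" by (rule ennreal_leI)
    also have "\<dots> = (\<integral>\<^sup>+\<omega>. ennreal (y * Z n \<omega>) \<partial>M)"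
      unfolding Z_def using integrable_exp_drift_occ[of "real n" \<sigma> "- ?\<kappa>"] \<sigma> y
      by (intro nn_integral_eq_integral[symmetric]) auto
    finally show ?thesis .
  qed
  have "ennreal (y * c) \<le> 0"
    using to0 ge by (intro LIMSEQ_le_const) auto
  with y c show False by (simp add: mult_le_0_iff)
qed

text \<open>A reward stopped at a finite time is at most the supremum of the absolute rewards, and
  stopping at infinity pays 0. The resulting bound on the expectation is the same for all
  \<open>\<tau>\<close>, and the negative part only lowers it.\<close>

lemma value_function_finite:
  assumes "\<rho> > \<mu> + growth rate \<sigma>"
  shows "value_function \<mu> \<sigma> a \<rho> M \<xi> y < \<infinity>"
proof -
  define I where "I = (\<integral>\<^sup>+\<omega>. (SUP t\<in>{0..}. ennreal \<bar>X t \<omega>\<bar>) \<partial>M)"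
  have I: "I < \<infinity>" using reward_sup_finite[OF assms] by (simp add: I_def)
  have "ext_expectation M (\<lambda>\<omega>. reward \<mu> \<sigma> a \<rho> \<xi> y (\<tau> \<omega>) \<omega>) \<le> enn2ereal I" for \<tau> :: "'a \<Rightarrow> ennreal"
  proof -
    let ?f = "\<lambda>\<omega>. reward \<mu> \<sigma> a \<rho> \<xi> y (\<tau> \<omega>) \<omega>"
    have "ennreal (?f \<omega>) \<le> (SUP t\<in>{0..}. ennreal \<bar>X t \<omega>\<bar>)" for \<omega>
    proof (cases "\<tau> \<omega>" rule: ennreal_cases)
      case (real t)
      have "ennreal (X t \<omega>) \<le> ennreal \<bar>X t \<omega>\<bar>" by (rule ennreal_leI) simp
      also have "\<dots> \<le> (SUP t\<in>{0..}. ennreal \<bar>X t \<omega>\<bar>)" by (rule SUP_upper) (use real in simp)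
      finally show ?thesis using real by simp
    next
      case top
      then show ?thesis by (simp add: reward_def)
    qed
    then have "(\<integral>\<^sup>+\<omega>. ennreal (?f \<omega>) \<partial>M) \<le> I"
      unfolding I_def by (rule nn_integral_mono)
    then have "enn2ereal (\<integral>\<^sup>+\<omega>. ennreal (?f \<omega>) \<partial>M) \<le> enn2ereal I"
      by (simp add: less_eq_ennreal.rep_eq)
    moreover have "ext_expectation M ?f \<le> enn2ereal (\<integral>\<^sup>+\<omega>. ennreal (?f \<omega>) \<partial>M)"
      unfolding ext_expectation_def by (rule ereal_diff_le_self) simp
    ultimately show ?thesis by (rule order_trans[rotated])
  qed
  then have "value_function \<mu> \<sigma> a \<rho> M \<xi> y \<le> enn2ereal I"
    unfolding value_function_def by (rule SUP_least)
  also have "\<dots> < \<infinity>" using I by (simp add: less_ennreal.rep_eq)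
  finally show ?thesis .
qed

end

theorem theorem1:
  fixes rate \<mu> \<sigma> a \<rho> y\<^sub>0 s\<^sub>0 :: real
    and M :: "'a measure" and \<xi> :: "real \<Rightarrow> 'a \<Rightarrow> real"
  assumes "rate > 0" "\<mu> > 0" "\<sigma> > 0" "a > 0" "\<rho> > 0"
    and "y\<^sub>0 > 0" "s\<^sub>0 \<in> states"
    and "flip_chain_from rate s\<^sub>0 M \<xi>"
  shows "(\<rho> > \<mu> - rate + sqrt (\<sigma>\<^sup>2 + rate\<^sup>2) \<longrightarrow> value_function \<mu> \<sigma> a \<rho> M \<xi> y\<^sub>0 < \<infinity>) \<and>
    (\<rho> > \<mu> - rate + sqrt (\<sigma>\<^sup>2 + rate\<^sup>2) \<longleftrightarrow>
      (\<integral>\<^sup>+\<omega>. (SUP t\<in>{0..}. ennreal \<bar>reward \<mu> \<sigma> a \<rho> \<xi> y\<^sub>0 (ennreal t) \<omega>\<bar>) \<partial>M) < \<infinity>) \<and>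
    (\<rho> < \<mu> - rate + sqrt (\<sigma>\<^sup>2 + rate\<^sup>2) \<longleftrightarrow>
      (SUP t\<in>{0..}. ext_expectation M (reward \<mu> \<sigma> a \<rho> \<xi> y\<^sub>0 (ennreal t))) = \<infinity>)"
proof -
  obtain p where "flip_chain M rate s\<^sub>0 \<xi> p"
    using flip_chain_fromD assms by blast
  then interpret switching_price M rate s\<^sub>0 \<xi> p \<mu> \<sigma> a \<rho> y\<^sub>0
    using assms by (simp add: switching_price_def switching_price_axioms_def)
  have *: "\<mu> - rate + sqrt (\<sigma>\<^sup>2 + rate\<^sup>2) = \<mu> + growth rate \<sigma>"
    by (simp add: growth_def)
  \<comment> \<open>The finite and infinite cases concern complementary ranges of
    \<open>\<rho>\<close>, which gives the equivalence.\<close>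
  have "(\<integral>\<^sup>+\<omega>. (SUP t\<in>{0..}. ennreal \<bar>X t \<omega>\<bar>) \<partial>M) < \<infinity> \<longleftrightarrow> \<rho> > \<mu> + growth rate \<sigma>"
    using reward_sup_finite reward_sup_infinite by (metis less_irrefl not_le)
  then show ?thesis
    unfolding * using value_function_finite SUP_expectation_reward_iff by simp
qed

end
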